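(* Let $k\ge 2$ be an integer and let $a\in(0,1]$ be fixed. The equation $$(1+a)(1-r)-r^k\left[2a^2+a+r(1-2a^2)\right]=0$$ has a unique solution in $(0,1)$; denote it by $\rho_k(a)$. For every $f\in\mathcal{B}_k$ with expansion $f(z)=\sum_{n=k}^{\infty}a_nz^n$ and $|a_k|=a$, the inequality $$\sum_{n=k}^{\infty}|a_n|r^n+\left(\frac{r^{-k}}{1+|a_k|}+\frac{r^{1-k}}{1-r}\right)\sum_{n=k}^{\infty}|a_n|^2r^{2n}\le 1$$ holds for all $r\in[0,\rho_k(a)]$. The upper bound $\rho_k(a)$ cannot be improved, i.e. $\rho_k(a)$ cannot be replaced by any larger number $\rho<1$: for every $\rho\in(\rho_k(a),1)$ there exist $f\in\mathcal{B}_k$ with $|a_k|=a$ and $r\in[0,\rho]$ for which the inequality fails.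
   Context: $\mathbb{D}=\{z\in\mathbb{C}:|z|<1\}$ is the open unit disk. $\mathcal{B}$ denotes the class of all analytic functions $f$ on $\mathbb{D}$ with $|f(z)|\le 1$ for all $z\in\mathbb{D}$. For $k\in\mathbb{N}$ (positive integers), $\mathcal{B}_k=\{f\in\mathcal{B}: f(0)=\cdots=f^{(k-1)}(0)=0\}$, so each $f\in\mathcal{B}_k$ has a power series $f(z)=\sum_{n=k}^\infty a_nz^n$ on $\mathbb{D}$. Convention: products such as $r^{-k}r^{2n}$ and $r^{1-k}r^{2n}$ are read as $r^{2n-k}$ and $r^{2n+1-k}$, so the left-hand side of the inequality equals $0$ at $r=0$. *)

theory Defs
  imports "HOL-Complex_Analysis.Complex_Analysis"
begin

definition class_B :: "(complex \<Rightarrow> complex) set" where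
  "class_B = {f. f analytic_on ball 0 1 \<and> (\<forall>z\<in>ball 0 1. norm (f z) \<le> 1)}"

definition class_B_vanishing :: "nat \<Rightarrow> (complex \<Rightarrow> complex) set" where
  "class_B_vanishing k = {f \<in> class_B. \<forall>j<k. (deriv ^^ j) f 0 = 0}"

abbreviation taylor_coeff :: "(complex \<Rightarrow> complex) \<Rightarrow> nat \<Rightarrow> complex" where
  "taylor_coeff f n \<equiv> fps_nth (fps_expansion f 0) n"

definition rho_fun :: "nat \<Rightarrow> real \<Rightarrow> real \<Rightarrow> real" where
  "rho_fun k a r = (1 + a) * (1 - r) - r ^ k * (2 * a\<^sup>2 + a + r * (1 - 2 * a\<^sup>2))"

definition rho :: "nat \<Rightarrow> real \<Rightarrow> real" where
  "rho k a = (THE r. r \<in> {0<..<1} \<and> rho_fun k a r = 0)"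

(* The negative powers of r are taken outside the sum. For r > 0 this is the same as
   reading the products termwise as r^(2n-k) and r^(2n+1-k); for r = 0 and k >= 2 both
   readings give 0, since 0 powi m = 0 for every negative m. *)
definition bohr_lhs :: "nat \<Rightarrow> (complex \<Rightarrow> complex) \<Rightarrow> real \<Rightarrow> real" where
  "bohr_lhs k f r =
     (\<Sum>\<^sub>\<infinity>n\<in>{k..}. norm (taylor_coeff f n) * r ^ n)
     + (r powi (- int k) / (1 + norm (taylor_coeff f k)) + r powi (1 - int k) / (1 - r))
       * (\<Sum>\<^sub>\<infinity>n\<in>{k..}. (norm (taylor_coeff f n))\<^sup>2 * r ^ (2 * n))"

text \<open>The infinite sums above converge for all relevant arguments, so the default value of
  a divergent sum never occurs, and the Taylor coefficients are those of the expansion of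
  \<open>f\<close> on the whole disk, starting at index \<open>k\<close>.\<close>

lemma class_B_holomorphic: "f \<in> class_B \<Longrightarrow> f holomorphic_on ball 0 1"
  by (auto simp: class_B_def analytic_imp_holomorphic)

lemma class_B_coeff_bound:
  assumes "f \<in> class_B"
  shows "norm (taylor_coeff f n) \<le> 1"
proof -
  have bound: "norm (taylor_coeff f n) * s ^ n \<le> 1" if s: "0 < s" "s < 1" for s
  proof -
    have "norm ((deriv ^^ n) f 0) \<le> fact n * 1 / s ^ n"
    proof (rule Cauchy_inequality)
      show "f holomorphic_on ball 0 s"
        using class_B_holomorphic[OF assms] by (rule holomorphic_on_subset) (use s in auto)
      show "continuous_on (cball 0 s) f"
        using holomorphic_on_imp_continuous_on[OF class_B_holomorphic[OF assms]]
        by (rule continuous_on_subset) (use s in auto)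
      show "norm (f x) \<le> 1" if "norm (0 - x) = s" for x
        using assms that s by (auto simp: class_B_def)
    qed (use s in auto)
    thus ?thesis
      using s by (simp add: fps_expansion_def norm_divide field_simps)
  qed
  have "((\<lambda>s. norm (taylor_coeff f n) * s ^ n) \<longlongrightarrow> norm (taylor_coeff f n) * 1 ^ n) (at_left 1)"
    by (intro tendsto_intros)
  moreover have "\<forall>\<^sub>F s in at_left 1. norm (taylor_coeff f n) * s ^ n \<le> 1"
    using eventually_at_left_real[of 0 1] by (auto elim!: eventually_mono intro!: bound)
  ultimately have "norm (taylor_coeff f n) * 1 ^ n \<le> 1"
    by (rule tendsto_upperbound) auto
  thus ?thesis by simp
qed

lemma bohr_lhs_summable:
  assumes "f \<in> class_B" "0 \<le> r" "r < 1"
  shows "(\<lambda>n. norm (taylor_coeff f n) * r ^ n) summable_on {k..}"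
    and "(\<lambda>n. (norm (taylor_coeff f n))\<^sup>2 * r ^ (2 * n)) summable_on {k..}"
proof -
  have geo: "(\<lambda>n. x ^ n) summable_on {k..}" if "0 \<le> x" "x < 1" for x :: real
    using that by (intro summable_on_subset_banach[OF norm_summable_imp_summable_on[of "\<lambda>n. x ^ n"]])
      (auto simp: power_abs)
  show "(\<lambda>n. norm (taylor_coeff f n) * r ^ n) summable_on {k..}"
    using assms by (intro summable_on_comparison_test[OF geo[of r]])
      (auto intro!: mult_left_le_one_le class_B_coeff_bound)
  have "r\<^sup>2 < 1"
    using assms by (simp add: power_less_one_iff abs_square_less_1)
  thus "(\<lambda>n. (norm (taylor_coeff f n))\<^sup>2 * r ^ (2 * n)) summable_on {k..}"
    using assms by (intro summable_on_comparison_test[OF geo[of "r\<^sup>2"]])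
      (auto simp: power_mult intro!: mult_left_le_one_le power_le_one class_B_coeff_bound)
qed

lemma class_B_vanishing_expansion:
  assumes "f \<in> class_B_vanishing k" "norm z < 1"
  shows "(\<lambda>n. taylor_coeff f (n + k) * z ^ (n + k)) sums f z"
proof -
  have "(\<lambda>n. taylor_coeff f n * z ^ n) sums f z"
    using holomorphic_power_series[of f 0 1 z] assms class_B_holomorphic[of f]
    by (auto simp: fps_expansion_def class_B_vanishing_def)
  moreover have "(\<Sum>n<k. taylor_coeff f n * z ^ n) = 0"
    using assms by (intro sum.neutral) (auto simp: fps_expansion_def class_B_vanishing_def)
  ultimately show ?thesis
    by (subst sums_iff_shift) simp
qed

lemma bohr_lhs_0: "k \<ge> 2 \<Longrightarrow> bohr_lhs k f 0 = 0"
  by (auto simp: bohr_lhs_def power_int_def power_0_left intro!: infsum_0)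

end

theory Submission
  imports Defs
begin

text \<open>
  Put b_n = a_(n+k). Multiplication by a function bounded by 1 contracts the square norm on circles,
  so the lower triangular Toeplitz matrices of b are contractions. Suitable test vectors give
  Carlson's inequalities |b_(2n+1)| \<le> 1 - (|b_0|^2 + ... + |b_n|^2) and
  |b_(2n)| \<le> 1 - (|b_0|^2 + ... + |b_(n-1)|^2) - |b_n|^2 / (1 + |b_0|).
  Summed against r^n, the negative terms cancel the weighted quadratic sum exactly, leaving
  the bound r^k (a + a^2/(1+a) + r/(1-r)) for the left-hand side. This is strictly increasing
  in r and reaches 1 at the root of the given equation; z^k (a - z)/(1 - a z) attains it at every r.
\<close>

subsection \<open>Toeplitz contractions\<close>

text \<open>This is Cauchy's formula for the derivative of order \<open>j\<close>, parametrised by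
  \<open>t\<close>: \<open>circlepath 0 r\<close> has derivative \<open>2 * pi * \<i>\<close> times
  itself, and on the circle dividing by \<open>z ^ j\<close> amounts to multiplying by
  \<open>cnj z ^ j / r ^ (2 * j)\<close>. No series has to be integrated termwise.\<close>

lemma circle_coeff_integral:
  assumes "h holomorphic_on ball 0 1" "0 < r" "r < 1"
  shows "((\<lambda>t. h (circlepath 0 r t) * cnj (circlepath 0 r t) ^ j) has_integral
           taylor_coeff h j * of_real (r ^ (2 * j))) {0..1}"
proof -
  have "((\<lambda>u. h u / (u - 0) ^ Suc j) has_contour_integral
          ((2 * pi * \<i>) / (fact j) * (deriv ^^ j) h 0)) (circlepath 0 r)"
  proof (rule Cauchy_has_contour_integral_higher_derivative_circlepath)
    show "continuous_on (cball 0 r) h"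
      by (rule continuous_on_subset[OF holomorphic_on_imp_continuous_on[OF assms(1)]])
        (use assms in auto)
    show "h holomorphic_on ball 0 r"
      by (rule holomorphic_on_subset[OF assms(1)]) (use assms in auto)
  qed (use assms in auto)
  moreover have "vector_derivative (circlepath 0 r) (at t) = 2 * pi * \<i> * circlepath 0 r t" for t
    by (simp only: vector_derivative_circlepath) (simp add: circlepath)
  ultimately have "((\<lambda>t. h (circlepath 0 r t) / circlepath 0 r t ^ Suc j * (2 * pi * \<i> * circlepath 0 r t))
           has_integral (2 * pi * \<i>) / (fact j) * (deriv ^^ j) h 0) {0..1}"
    by (simp only: has_contour_integral diff_0_right)
  from has_integral_mult_right[OF this, of "of_real (r ^ (2 * j)) / (2 * pi * \<i>)"]
  have *: "((\<lambda>t. of_real (r ^ (2 * j)) / (2 * pi * \<i>) * (h (circlepath 0 r t) / circlepath 0 r t ^ Suc j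
             * (2 * pi * \<i> * circlepath 0 r t)))
           has_integral taylor_coeff h j * of_real (r ^ (2 * j))) {0..1}"
    by (simp add: fps_expansion_def mult_ac)
  have "of_real (r ^ (2 * j)) / (2 * pi * \<i>) * (h z / z ^ Suc j * (2 * pi * \<i> * z)) = h z * cnj z ^ j"
    if "norm z = r" for z :: complex
  proof -
    have "z \<noteq> 0" using that assms by auto
    have "z * cnj z = of_real (r ^ 2)"
      using that by (simp add: complex_norm_square[symmetric])
    hence "z ^ j * cnj z ^ j = of_real (r ^ (2 * j))"
      by (metis of_real_power power_mult power_mult_distrib)
    thus ?thesis using \<open>z \<noteq> 0\<close> by (simp add: field_simps flip: of_real_power)
  qed
  moreover have "norm (circlepath 0 r t) = r" for t
    using assms by (simp add: circlepath norm_mult norm_exp_eq_Re)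
  ultimately show ?thesis
    using * by simp
qed

text \<open>A Cauchy product; the conditional cuts \<open>c\<close> off after \<open>N\<close>,
  since \<open>c\<close> is an arbitrary sequence of which the polynomial uses only a
  segment.\<close>

lemma taylor_coeff_mult_polynomial:
  assumes "f holomorphic_on ball 0 1"
  shows "taylor_coeff (\<lambda>z. f z * (\<Sum>i\<le>N. c i * z ^ i)) m =
         (\<Sum>i\<le>m. taylor_coeff f i * (if m - i \<le> N then c (m - i) else 0))"
proof -
  have "f has_fps_expansion fps_expansion f 0"
    by (rule has_fps_expansion_fps_expansion[OF _ _ assms]) auto
  hence "(\<lambda>z. f z * (\<Sum>i\<le>N. c i * z ^ i)) has_fps_expansion
      fps_expansion f 0 * (\<Sum>i\<le>N. fps_const (c i) * fps_X ^ i)"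
    by (intro fps_expansion_intros)
  hence "fps_expansion (\<lambda>z. f z * (\<Sum>i\<le>N. c i * z ^ i)) 0 =
      fps_expansion f 0 * (\<Sum>i\<le>N. fps_const (c i) * fps_X ^ i)"
    by (rule fps_expansion_eqI)
  moreover have "fps_nth (\<Sum>i\<le>N. fps_const (c i) * fps_X ^ i) n = (if n \<le> N then c n else 0)" for n
    by (simp add: fps_sum_nth if_distrib[of "\<lambda>x. _ * x"] sum.delta cong: if_cong)
  ultimately show ?thesis
    by (simp add: fps_mult_nth atMost_atLeast0)
qed

lemma taylor_coeff_polynomial:
  "taylor_coeff (\<lambda>z. \<Sum>i\<le>N. c i * z ^ i) m = (if m \<le> N then c m else 0)"
proof -
  have "fps_expansion (\<lambda>z. \<Sum>i\<le>N. c i * z ^ i) 0 = (\<Sum>i\<le>N. fps_const (c i) * fps_X ^ i)"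
    by (intro fps_expansion_eqI fps_expansion_intros)
  thus ?thesis
    by (simp add: fps_sum_nth if_distrib[of "\<lambda>x. _ * x"] sum.delta cong: if_cong)
qed

lemma circle_inner_polynomial:
  assumes "h holomorphic_on ball 0 1" "0 < r" "r < 1"
  shows "((\<lambda>t. h (circlepath 0 r t) * cnj (\<Sum>i\<le>N. c i * circlepath 0 r t ^ i)) has_integral
           (\<Sum>i\<le>N. taylor_coeff h i * cnj (c i) * of_real (r ^ (2 * i)))) {0..1}"
proof -
  have "((\<lambda>t. \<Sum>i\<le>N. cnj (c i) * (h (circlepath 0 r t) * cnj (circlepath 0 r t) ^ i)) has_integral
           (\<Sum>i\<le>N. cnj (c i) * (taylor_coeff h i * of_real (r ^ (2 * i))))) {0..1}"
    by (intro has_integral_sum has_integral_mult_right circle_coeff_integral assms) auto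
  thus ?thesis
    by (simp add: sum_distrib_left mult_ac)
qed

lemma Parseval_polynomial:
  assumes "0 < r" "r < 1"
  shows "((\<lambda>t. (norm (\<Sum>i\<le>N. c i * circlepath 0 r t ^ i))\<^sup>2) has_integral
           (\<Sum>i\<le>N. (norm (c i))\<^sup>2 * r ^ (2 * i))) {0..1}"
proof -
  have "((\<lambda>t. (\<Sum>i\<le>N. c i * circlepath 0 r t ^ i) * cnj (\<Sum>i\<le>N. c i * circlepath 0 r t ^ i))
      has_integral (\<Sum>i\<le>N. taylor_coeff (\<lambda>z. \<Sum>i\<le>N. c i * z ^ i) i * cnj (c i) * of_real (r ^ (2 * i)))) {0..1}"
    by (rule circle_inner_polynomial) (use assms in \<open>auto intro!: holomorphic_intros\<close>)
  note int = this
  have sum_eq: "(\<Sum>i\<le>N. taylor_coeff (\<lambda>z. \<Sum>i\<le>N. c i * z ^ i) i * cnj (c i) * of_real (r ^ (2 * i))) =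
      of_real (\<Sum>i\<le>N. (norm (c i))\<^sup>2 * r ^ (2 * i))"
    unfolding of_real_sum taylor_coeff_polynomial
    by (rule sum.cong) (simp_all add: complex_norm_square del: of_real_power)
  show ?thesis
    using has_integral_Re[OF int] by (simp only: complex_norm_square[symmetric] sum_eq Re_complex_of_real)
qed

text \<open>With \<open>q\<close> the Taylor polynomial of degree at most \<open>N\<close>, both the
  mean of \<open>Re (h * cnj q)\<close> and the mean of the squared modulus of \<open>q\<close>
  equal \<open>E\<close>. Hence the nonnegative mean of the squared modulus of \<open>h - q\<close>
  is that of \<open>h\<close> minus \<open>E\<close>.\<close>

lemma Bessel_circle:
  assumes "h holomorphic_on ball 0 1" "0 < r" "r < 1"
  shows "(\<Sum>i\<le>N. (norm (taylor_coeff h i))\<^sup>2 * r ^ (2 * i))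
         \<le> integral {0..1} (\<lambda>t. (norm (h (circlepath 0 r t)))\<^sup>2)"
    and "(\<lambda>t. (norm (h (circlepath 0 r t)))\<^sup>2) integrable_on {0..1}"
proof -
  define q where "q z = (\<Sum>i\<le>N. taylor_coeff h i * z ^ i)" for z
  define E where "E = (\<Sum>i\<le>N. (norm (taylor_coeff h i))\<^sup>2 * r ^ (2 * i))"
  have norm_circle: "norm (circlepath 0 r t) = r" for t
    using assms by (simp add: circlepath norm_mult norm_exp_eq_Re)
  have "continuous_on {0..1} (\<lambda>t. h (circlepath 0 r t))"
    by (rule continuous_on_compose2[OF holomorphic_on_imp_continuous_on[OF assms(1)]])
      (use assms norm_circle in \<open>auto simp: circlepath intro!: continuous_intros\<close>)
  thus int: "(\<lambda>t. (norm (h (circlepath 0 r t)))\<^sup>2) integrable_on {0..1}"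
    by (intro integrable_continuous_real continuous_intros)
  have 1: "((\<lambda>t. Re (h (circlepath 0 r t) * cnj (q (circlepath 0 r t)))) has_integral E) {0..1}"
    using has_integral_Re[OF circle_inner_polynomial[OF assms, of "taylor_coeff h" N]]
    unfolding q_def E_def by (simp add: complex_norm_square[symmetric] flip: of_real_power of_real_mult)
  have 2: "((\<lambda>t. (norm (q (circlepath 0 r t)))\<^sup>2) has_integral E) {0..1}"
    unfolding q_def E_def by (rule Parseval_polynomial) fact+
  have expand: "(norm (x - y))\<^sup>2 = (norm x)\<^sup>2 - 2 * Re (x * cnj y) + (norm y)\<^sup>2" for x y :: complex
    unfolding cmod_power2 by (simp add: power2_eq_square algebra_simps)
  have "((\<lambda>t. (norm (h (circlepath 0 r t) - q (circlepath 0 r t)))\<^sup>2) has_integral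
      integral {0..1} (\<lambda>t. (norm (h (circlepath 0 r t)))\<^sup>2) - 2 * E + E) {0..1}"
    unfolding expand
    by (intro has_integral_add has_integral_diff has_integral_mult_right 1 2 integrable_integral int)
  hence "0 \<le> integral {0..1} (\<lambda>t. (norm (h (circlepath 0 r t)))\<^sup>2) - 2 * E + E"
    by (rule has_integral_nonneg) auto
  thus "E \<le> integral {0..1} (\<lambda>t. (norm (h (circlepath 0 r t)))\<^sup>2)" by simp
qed

text \<open>On a circle \<open>f * p\<close> is dominated by \<open>p\<close>; Bessel bounds the
  coefficients of the product, Parseval evaluates the mean of \<open>p\<close>. The cut-offs
  \<open>M\<close> and \<open>N\<close> are independent, which leaves room for an index shift by
  \<open>k\<close>.\<close>

lemma class_B_multiplier_contraction:
  assumes "f \<in> class_B"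
  shows "(\<Sum>m\<le>M. (norm (\<Sum>i\<le>m. taylor_coeff f i * (if m - i \<le> N then c (m - i) else 0)))\<^sup>2)
         \<le> (\<Sum>m\<le>N. (norm (c m))\<^sup>2)"
proof -
  define d where "d m = (norm (\<Sum>i\<le>m. taylor_coeff f i * (if m - i \<le> N then c (m - i) else 0)))\<^sup>2" for m
  define p where "p z = (\<Sum>i\<le>N. c i * z ^ i)" for z
  have hol: "(\<lambda>z. f z * p z) holomorphic_on ball 0 1"
    unfolding p_def by (intro holomorphic_intros class_B_holomorphic assms)
  have bound: "(\<Sum>m\<le>M. d m * r ^ (2 * m)) \<le> (\<Sum>m\<le>N. (norm (c m))\<^sup>2)" if r: "0 < r" "r < 1" for r
  proof -
    have norm_circle: "norm (circlepath 0 r t) = r" for t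
      using r by (simp add: circlepath norm_mult norm_exp_eq_Re)
    have "(\<Sum>m\<le>M. d m * r ^ (2 * m)) = (\<Sum>m\<le>M. (norm (taylor_coeff (\<lambda>z. f z * p z) m))\<^sup>2 * r ^ (2 * m))"
      unfolding d_def p_def taylor_coeff_mult_polynomial[OF class_B_holomorphic[OF assms]] ..
    also have "\<dots> \<le> integral {0..1} (\<lambda>t. (norm (f (circlepath 0 r t) * p (circlepath 0 r t)))\<^sup>2)"
      by (rule Bessel_circle(1)[OF hol r])
    also have "\<dots> \<le> integral {0..1} (\<lambda>t. (norm (p (circlepath 0 r t)))\<^sup>2)"
    proof (rule integral_le)
      show "(\<lambda>t. (norm (p (circlepath 0 r t)))\<^sup>2) integrable_on {0..1}"
        using Parseval_polynomial[OF r, of c N] unfolding p_def by blast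
      show "(norm (f (circlepath 0 r t) * p (circlepath 0 r t)))\<^sup>2 \<le> (norm (p (circlepath 0 r t)))\<^sup>2" for t
        using assms r norm_circle[of t]
        by (intro power_mono) (auto simp: norm_mult class_B_def intro!: mult_left_le_one_le)
    qed (rule Bessel_circle(2)[OF hol r])
    also have "\<dots> = (\<Sum>m\<le>N. (norm (c m))\<^sup>2 * r ^ (2 * m))"
      using Parseval_polynomial[OF r, of c N] unfolding p_def by (rule integral_unique)
    also have "\<dots> \<le> (\<Sum>m\<le>N. (norm (c m))\<^sup>2)"
      using r by (intro sum_mono) (auto intro!: mult_right_le_one_le power_le_one)
    finally show ?thesis .
  qed
  \<comment> \<open>Only finite sums remain, so the radius may tend to 1.\<close>
  have "((\<lambda>r. \<Sum>m\<le>M. d m * r ^ (2 * m)) \<longlongrightarrow> (\<Sum>m\<le>M. d m * 1 ^ (2 * m))) (at_left 1)"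
    by (intro tendsto_intros)
  moreover have "\<forall>\<^sub>F r in at_left 1. (\<Sum>m\<le>M. d m * r ^ (2 * m)) \<le> (\<Sum>m\<le>N. (norm (c m))\<^sup>2)"
    using eventually_at_left_real[of 0 1] by (auto elim!: eventually_mono intro!: bound)
  ultimately have "(\<Sum>m\<le>M. d m * 1 ^ (2 * m)) \<le> (\<Sum>m\<le>N. (norm (c m))\<^sup>2)"
    by (rule tendsto_upperbound) auto
  thus ?thesis by (simp add: d_def)
qed

text \<open>For each \<open>N\<close>, the lower triangular Toeplitz matrix with first column
  \<open>b 0, ..., b N\<close> has operator norm at most 1. Only the entries of \<open>c\<close> up
  to \<open>N\<close> enter, so an unrestricted sequence can stand for a vector.\<close>

definition toeplitz_contraction :: "(nat \<Rightarrow> complex) \<Rightarrow> bool" where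
  "toeplitz_contraction b \<longleftrightarrow>
     (\<forall>c N. (\<Sum>m\<le>N. (norm (\<Sum>i\<le>m. b i * c (m - i)))\<^sup>2) \<le> (\<Sum>m\<le>N. (norm (c m))\<^sup>2))"

lemma toeplitz_contractionD:
  assumes "toeplitz_contraction b"
  shows "(\<Sum>m\<le>N. (norm (\<Sum>i\<le>m. b i * c (m - i)))\<^sup>2) \<le> (\<Sum>m\<le>N. (norm (c m))\<^sup>2)"
  using assms by (simp add: toeplitz_contraction_def)

text \<open>The first \<open>k\<close> coefficients of \<open>f\<close> vanish, so from index
  \<open>k\<close> on the coefficients of \<open>f * p\<close> are convolutions with the shifted
  sequence. This takes the place of dividing \<open>f\<close> by \<open>z ^ k\<close> and applying
  the Schwarz lemma.\<close>

lemma class_B_vanishing_toeplitz_contraction: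
  assumes "f \<in> class_B_vanishing k"
  shows "toeplitz_contraction (\<lambda>n. taylor_coeff f (n + k))"
  unfolding toeplitz_contraction_def
proof (intro allI)
  fix c :: "nat \<Rightarrow> complex" and N
  define d where "d m = (\<Sum>i\<le>m. taylor_coeff f i * (if m - i \<le> N then c (m - i) else 0))" for m
  have d: "d (m + k) = (\<Sum>i\<le>m. taylor_coeff f (i + k) * c (m - i))" if "m \<le> N" for m
  proof -
    have "d (m + k) = (\<Sum>i\<in>{k..m+k}. taylor_coeff f i * (if m + k - i \<le> N then c (m + k - i) else 0))"
      unfolding d_def
      by (rule sum.mono_neutral_right) (use assms in \<open>auto simp: class_B_vanishing_def fps_expansion_def\<close>)
    also have "\<dots> = (\<Sum>i\<le>m. taylor_coeff f (i + k) * c (m - i))"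
      by (rule sum.reindex_bij_witness[of _ "\<lambda>i. i + k" "\<lambda>i. i - k"]) (use that in auto)
    finally show ?thesis .
  qed
  have "(\<Sum>m\<le>N. (norm (\<Sum>i\<le>m. taylor_coeff f (i + k) * c (m - i)))\<^sup>2) = (\<Sum>m\<le>N. (norm (d (m + k)))\<^sup>2)"
    by (intro sum.cong) (simp_all add: d)
  also have "\<dots> = (\<Sum>m\<in>{k..N+k}. (norm (d m))\<^sup>2)"
    by (rule sum.reindex_bij_witness[of _ "\<lambda>i. i - k" "\<lambda>i. i + k"]) auto
  also have "\<dots> \<le> (\<Sum>m\<le>N+k. (norm (d m))\<^sup>2)"
    by (rule sum_mono2) auto
  also have "\<dots> \<le> (\<Sum>m\<le>N. (norm (c m))\<^sup>2)"
    unfolding d_def by (rule class_B_multiplier_contraction) (use assms in \<open>auto simp: class_B_vanishing_def\<close>)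
  finally show "(\<Sum>m\<le>N. (norm (\<Sum>i\<le>m. taylor_coeff f (i + k) * c (m - i)))\<^sup>2) \<le> (\<Sum>m\<le>N. (norm (c m))\<^sup>2)" .
qed

subsection \<open>Carlson's coefficient inequalities\<close>

text \<open>A quadratic polynomial in \<open>t\<close> that is nonnegative on the real line has
  nonpositive discriminant. The conclusion is free of division, so it covers every sign of the
  leading coefficient \<open>C\<close>.\<close>

lemma real_quadratic_bound:
  fixes x y A e :: real
  assumes "\<And>t. (x + t * y)\<^sup>2 \<le> A + e * t\<^sup>2"
  shows "x\<^sup>2 * e \<le> A * (e - y\<^sup>2)"
proof -
  define C where "C = e - y\<^sup>2"
  have q: "0 \<le> (A - x\<^sup>2) - 2 * (x * y) * t + C * t\<^sup>2" for t
    using assms[of t] by (simp add: C_def power2_eq_square algebra_simps)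
  have Ax: "x\<^sup>2 \<le> A" using q[of 0] by simp
  have "C < 0 \<or> C = 0 \<or> C > 0" by linarith
  thus ?thesis
  proof (elim disjE)
    assume C: "C < 0"
    \<comment> \<open>With this \<open>t\<close> the values of the polynomial at \<open>t\<close>
      and \<open>-t\<close> add up to -2, so a negative \<open>C\<close> is impossible.\<close>
    define t where "t = sqrt ((A - x\<^sup>2 + 1) / (- C))"
    have t: "C * t\<^sup>2 = - (A - x\<^sup>2 + 1)"
      using C Ax by (simp add: t_def divide_nonneg_pos field_simps)
    have "0 \<le> 2 * (A - x\<^sup>2) + 2 * (C * t\<^sup>2)"
      using q[of t] q[of "-t"] by simp
    thus ?thesis using Ax t by simp
  next
    assume C: "C = 0"
    have "x * y = 0"
    proof (rule ccontr)
      assume "x * y \<noteq> 0"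
      thus False using q[of "(A - x\<^sup>2 + 1) / (2 * (x * y))"] C by simp
    qed
    thus ?thesis using C by (auto simp: C_def)
  next
    assume C: "C > 0"
    \<comment> \<open>The polynomial attains its minimum at \<open>x * y / C\<close>.\<close>
    have "(A - x\<^sup>2) - 2 * (x * y) * (x * y / C) + C * (x * y / C)\<^sup>2 = ((A - x\<^sup>2) * C - (x * y)\<^sup>2) / C"
      using C by (simp add: field_simps power2_eq_square)
    hence "0 \<le> (A - x\<^sup>2) * C - (x * y)\<^sup>2"
      using q[of "x * y / C"] C by (simp add: zero_le_divide_iff)
    thus ?thesis by (simp add: C_def algebra_simps power_mult_distrib)
  qed
qed

text \<open>Choosing the phase of \<open>w\<close> so that \<open>b * w\<close> points along
  \<open>X\<close> makes the moduli add, which reduces the claim to real parameters.\<close>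

lemma complex_quadratic_bound:
  fixes X b :: complex and A e :: real
  assumes "\<And>w. (norm (X + b * w))\<^sup>2 \<le> A + e * (norm w)\<^sup>2"
  shows "(norm X)\<^sup>2 * e \<le> A * (e - (norm b)\<^sup>2)"
proof (rule real_quadratic_bound)
  fix t :: real
  obtain \<omega> where \<omega>: "norm \<omega> = 1" "(norm (X + b * (of_real t * \<omega>)))\<^sup>2 = (norm X + t * norm b)\<^sup>2"
  proof (cases "X = 0 \<or> b = 0")
    case True
    show ?thesis by (rule that[of 1]) (use True in \<open>auto simp: norm_mult power_mult_distrib\<close>)
  next
    case False
    have "X + b * (of_real t * (sgn X * of_real (norm b) / b)) = of_real (norm X + t * norm b) * sgn X"
      using False by (simp add: sgn_div_norm scaleR_conv_of_real field_simps)
    hence "norm (X + b * (of_real t * (sgn X * of_real (norm b) / b))) = \<bar>norm X + t * norm b\<bar>"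
      using False by (simp only: norm_mult norm_of_real norm_sgn) simp
    thus ?thesis
      using False by (intro that[of "sgn X * of_real (norm b) / b"]) (auto simp: norm_mult norm_divide norm_sgn)
  qed
  show "(norm X + t * norm b)\<^sup>2 \<le> A + e * t\<^sup>2"
    using assms[of "of_real t * \<omega>"] \<omega> by (simp add: norm_mult)
qed

text \<open>The first unit vector is mapped to the first column of the matrix.\<close>

lemma toeplitz_contraction_sum_le_1:
  assumes "toeplitz_contraction b"
  shows "(\<Sum>i\<le>n. (norm (b i))\<^sup>2) \<le> 1"
proof -
  have "(\<Sum>m\<le>n. (norm (\<Sum>i\<le>m. b i * (if m - i = 0 then 1 else 0)))\<^sup>2)
      \<le> (\<Sum>m\<le>n. (norm (if m = 0 then 1 else 0 :: complex))\<^sup>2)"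
    by (rule toeplitz_contractionD[OF assms, of "\<lambda>m. if m = 0 then 1 else 0" n])
  moreover have "(\<Sum>i\<le>m. b i * (if m - i = 0 then 1 else 0)) = b m" for m
  proof -
    have "(\<Sum>i\<le>m. b i * (if m - i = 0 then 1 else 0)) = (\<Sum>i\<le>m. if i = m then b i else 0)"
      by (rule sum.cong) auto
    thus ?thesis by simp
  qed
  moreover have "(\<Sum>m\<le>n. (norm (if m = 0 then 1 else 0 :: complex))\<^sup>2) = 1"
    by (simp add: if_distrib[of norm] if_distrib[of "\<lambda>x. x\<^sup>2"] cong: if_cong)
  ultimately show ?thesis by simp
qed

text \<open>The test vector is 1 followed by a multiple of the reversed and conjugated coefficients,
  so that the convolution at the top index contains the sum of their squares.\<close>

lemma Carlson_odd:
  assumes b: "toeplitz_contraction b"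
  shows "norm (b (2 * n + 1)) \<le> 1 - (\<Sum>i\<le>n. (norm (b i))\<^sup>2)"
proof -
  define S where "S = (\<Sum>i\<le>n. (norm (b i))\<^sup>2)"
  have S: "0 \<le> S" "S \<le> 1"
    using toeplitz_contraction_sum_le_1[OF b] by (auto simp: S_def sum_nonneg)
  have "(norm (b (2 * n + 1) + of_real S * s))\<^sup>2 \<le> (1 - S) + S * (norm s)\<^sup>2" for s
  proof -
    define c where "c i = (if i = 0 then 1 else if i \<le> n then 0 else s * cnj (b (2 * n + 1 - i)))" for i
    have low: "(\<Sum>i\<le>m. b i * c (m - i)) = b m" if "m \<le> n" for m
    proof -
      have "(\<Sum>i\<le>m. b i * c (m - i)) = (\<Sum>i\<le>m. if i = m then b i else 0)"
        by (rule sum.cong) (use that in \<open>auto simp: c_def\<close>)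
      thus ?thesis by simp
    qed
    have top: "(\<Sum>i\<le>2*n+1. b i * c (2*n+1 - i)) = b (2*n+1) + of_real S * s"
    proof -
      have "(\<Sum>i\<le>2*n+1. b i * c (2*n+1 - i)) =
          (\<Sum>i\<in>insert (2*n+1) {..n}. b i * c (2*n+1 - i))"
        by (rule sum.mono_neutral_right) (auto simp: c_def)
      also have "\<dots> = b (2*n+1) + (\<Sum>i\<le>n. b i * c (2*n+1 - i))"
        by (subst sum.insert) (auto simp: c_def)
      also have "(\<Sum>i\<le>n. b i * c (2*n+1 - i)) = (\<Sum>i\<le>n. of_real ((norm (b i))\<^sup>2) * s)"
        by (rule sum.cong) (auto simp: c_def complex_norm_square mult_ac simp del: of_real_power)
      finally show ?thesis by (simp add: S_def sum_distrib_right)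
    qed
    \<comment> \<open>Of the rows of the image only 0 to \<open>n\<close> and the last are kept; the
      others contribute nonnegative squares.\<close>
    have "S + (norm (b (2*n+1) + of_real S * s))\<^sup>2 =
        (\<Sum>m\<in>insert (2*n+1) {..n}. (norm (\<Sum>i\<le>m. b i * c (m - i)))\<^sup>2)"
    proof -
      have "(\<Sum>m\<le>n. (norm (\<Sum>i\<le>m. b i * c (m - i)))\<^sup>2) = S"
        unfolding S_def by (rule sum.cong) (auto simp: low)
      thus ?thesis
        by (subst sum.insert) (simp_all only: top finite_atMost, auto)
    qed
    also have "\<dots> \<le> (\<Sum>m\<le>2*n+1. (norm (\<Sum>i\<le>m. b i * c (m - i)))\<^sup>2)"
      by (rule sum_mono2) auto
    also have "\<dots> \<le> (\<Sum>m\<le>2*n+1. (norm (c m))\<^sup>2)"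
      by (rule toeplitz_contractionD[OF b])
    also have "\<dots> = (\<Sum>m\<in>insert 0 {n+1..2*n+1}. (norm (c m))\<^sup>2)"
      by (rule sum.mono_neutral_right) (auto simp: c_def)
    also have "\<dots> = 1 + (\<Sum>m\<in>{n+1..2*n+1}. (norm (c m))\<^sup>2)"
      by (subst sum.insert) (auto simp: c_def)
    also have "(\<Sum>m\<in>{n+1..2*n+1}. (norm (c m))\<^sup>2) = (\<Sum>i\<le>n. (norm (b i))\<^sup>2 * (norm s)\<^sup>2)"
      by (rule sum.reindex_bij_witness[of _ "\<lambda>i. 2*n+1-i" "\<lambda>i. 2*n+1-i"])
        (auto simp: c_def norm_mult power_mult_distrib)
    finally show ?thesis
      unfolding sum_distrib_right[symmetric] S_def[symmetric] by simp
  qed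
  \<comment> \<open>Eliminating \<open>s\<close> leaves a factor \<open>S\<close> on both sides. It
    cannot be cancelled when \<open>S = 0\<close>, where the inequality at \<open>s = 0\<close>
    gives the bound instead.\<close>
  from complex_quadratic_bound[OF this] S
  have *: "(norm (b (2 * n + 1)))\<^sup>2 * S \<le> (1 - S) * (1 - S) * S" and "(norm (b (2 * n + 1)))\<^sup>2 \<le> 1 - S"
    using \<open>\<And>s. (norm (b (2 * n + 1) + of_real S * s))\<^sup>2 \<le> (1 - S) + S * (norm s)\<^sup>2\<close>[of 0]
    by (simp_all add: power2_eq_square algebra_simps)
  hence "(norm (b (2 * n + 1)))\<^sup>2 \<le> (1 - S)\<^sup>2"
    using S by (cases "S = 0") (auto simp: power2_eq_square)
  thus ?thesis
    using S unfolding S_def[symmetric] by (simp add: power2_le_iff_abs_le)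
qed

text \<open>The index \<open>n\<close> is its own mirror image under reflection in
  \<open>2 * n\<close>, so the entry \<open>u\<close> of the test vector at \<open>n\<close> is a
  second free parameter, and row \<open>n\<close> of the image also has to be taken into
  account.\<close>

lemma Carlson_even:
  assumes b: "toeplitz_contraction b" and n: "n \<ge> 1"
  shows "norm (b (2 * n)) \<le> 1 - (\<Sum>i<n. (norm (b i))\<^sup>2) - (norm (b n))\<^sup>2 / (1 + norm (b 0))"
proof -
  define S where "S = (\<Sum>i<n. (norm (b i))\<^sup>2)"
  define T where "T = 1 - S"
  define d where "d = 1 - (norm (b 0))\<^sup>2"
  have S0: "(norm (b 0))\<^sup>2 \<le> S"
    unfolding S_def by (rule member_le_sum) (use n in auto)
  have Sb: "S + (norm (b n))\<^sup>2 \<le> 1"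
    using toeplitz_contraction_sum_le_1[OF b, of n] by (simp add: S_def lessThan_Suc_atMost[symmetric])
  have Sb2: "S + (norm (b n))\<^sup>2 + (norm (b (2*n)))\<^sup>2 \<le> 1"
  proof -
    have "S + (norm (b n))\<^sup>2 + (norm (b (2*n)))\<^sup>2 = (\<Sum>i\<in>insert (2*n) (insert n {..<n}). (norm (b i))\<^sup>2)"
      using n by (auto simp: S_def)
    also have "\<dots> \<le> (\<Sum>i\<le>2*n. (norm (b i))\<^sup>2)"
      by (rule sum_mono2) auto
    also have "\<dots> \<le> 1" by (rule toeplitz_contraction_sum_le_1[OF b])
    finally show ?thesis .
  qed
  have S: "0 \<le> S" "S \<le> 1"
    using Sb by (auto simp: S_def sum_nonneg) (smt (verit) zero_le_power2)
  have main: "(norm (b (2 * n) + b n * u + of_real S * s))\<^sup>2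
      \<le> (T + (norm u)\<^sup>2 - (norm (b n + b 0 * u))\<^sup>2) + S * (norm s)\<^sup>2" for u s
  proof -
    define c where "c i = (if i = 0 then 1 else if i < n then 0 else if i = n then u
        else s * cnj (b (2 * n - i)))" for i
    have low: "(\<Sum>i\<le>m. b i * c (m - i)) = b m" if "m < n" for m
    proof -
      have "(\<Sum>i\<le>m. b i * c (m - i)) = (\<Sum>i\<le>m. if i = m then b i else 0)"
        by (rule sum.cong) (use that in \<open>auto simp: c_def\<close>)
      thus ?thesis by simp
    qed
    have mid: "(\<Sum>i\<le>n. b i * c (n - i)) = b n + b 0 * u"
    proof -
      have "(\<Sum>i\<le>n. b i * c (n - i)) = (\<Sum>i\<in>{n, 0}. b i * c (n - i))"
        by (rule sum.mono_neutral_right) (auto simp: c_def)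
      thus ?thesis using n by (simp add: c_def)
    qed
    have top: "(\<Sum>i\<le>2*n. b i * c (2*n - i)) = b (2*n) + b n * u + of_real S * s"
    proof -
      have "(\<Sum>i\<le>2*n. b i * c (2*n - i)) =
          (\<Sum>i\<in>insert (2*n) (insert n {..<n}). b i * c (2*n - i))"
        by (rule sum.mono_neutral_right) (auto simp: c_def)
      also have "\<dots> = b (2*n) + b n * u + (\<Sum>i<n. b i * c (2*n - i))"
        using n by (auto simp: c_def)
      also have "(\<Sum>i<n. b i * c (2*n - i)) = (\<Sum>i<n. of_real ((norm (b i))\<^sup>2) * s)"
        by (rule sum.cong) (auto simp: c_def complex_norm_square mult_ac simp del: of_real_power)
      finally show ?thesis by (simp add: S_def sum_distrib_right)
    qed
    have "S + (norm (b n + b 0 * u))\<^sup>2 + (norm (b (2*n) + b n * u + of_real S * s))\<^sup>2 =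
        (\<Sum>m\<in>insert (2*n) (insert n {..<n}). (norm (\<Sum>i\<le>m. b i * c (m - i)))\<^sup>2)"
      using top mid low n by (auto simp: S_def)
    also have "\<dots> \<le> (\<Sum>m\<le>2*n. (norm (\<Sum>i\<le>m. b i * c (m - i)))\<^sup>2)"
      by (rule sum_mono2) auto
    also have "\<dots> \<le> (\<Sum>m\<le>2*n. (norm (c m))\<^sup>2)"
      by (rule toeplitz_contractionD[OF b])
    also have "\<dots> = (\<Sum>m\<in>insert 0 (insert n {n+1..2*n}). (norm (c m))\<^sup>2)"
      by (rule sum.mono_neutral_right) (auto simp: c_def)
    also have "\<dots> = 1 + (norm u)\<^sup>2 + (\<Sum>m\<in>{n+1..2*n}. (norm (c m))\<^sup>2)"
      using n by (auto simp: c_def)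
    also have "(\<Sum>m\<in>{n+1..2*n}. (norm (c m))\<^sup>2) = (\<Sum>i<n. (norm (b i))\<^sup>2 * (norm s)\<^sup>2)"
      by (rule sum.reindex_bij_witness[of _ "\<lambda>i. 2*n-i" "\<lambda>i. 2*n-i"])
        (auto simp: c_def norm_mult power_mult_distrib)
    finally show ?thesis
      unfolding sum_distrib_right[symmetric] S_def[symmetric] by (simp add: T_def)
  qed
  \<comment> \<open>Optimising first over s and then over the deviation w of u from its optimal value u0
    yields the bound P for the modulus of X.\<close>
  have elim_s: "(norm (b (2 * n) + b n * u))\<^sup>2 \<le> (T + (norm u)\<^sup>2 - (norm (b n + b 0 * u))\<^sup>2) * T" for u
  proof (cases "S = 0")
    case True
    thus ?thesis using main[of u 0] by (simp add: T_def)
  next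
    case False
    have "(norm (b (2 * n) + b n * u))\<^sup>2 * S
        \<le> (T + (norm u)\<^sup>2 - (norm (b n + b 0 * u))\<^sup>2) * (S - (norm (of_real S :: complex))\<^sup>2)"
      using main[of u] by (rule complex_quadratic_bound)
    also have "S - (norm (of_real S :: complex))\<^sup>2 = T * S"
      by (simp add: T_def power2_eq_square algebra_simps)
    finally show ?thesis using False S by simp
  qed
  show ?thesis
  \<comment> \<open>Since \<open>d\<close> is at least \<open>T\<close>, it can vanish only when
    \<open>T = 0\<close>. In that case the square sum is exhausted and the remaining coefficients
    are 0.\<close>
  proof (cases "T = 0")
    case True
    hence "(norm (b n))\<^sup>2 + (norm (b (2*n)))\<^sup>2 \<le> 0"
      using Sb2 by (simp add: T_def)
    hence "b n = 0" "b (2 * n) = 0"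
      by (simp_all add: sum_power2_le_zero_iff)
    thus ?thesis using True by (simp add: T_def S_def)
  next
    case False
    hence T: "T > 0" using S by (simp add: T_def)
    hence d: "d > 0" using S0 by (simp add: d_def T_def)
    \<comment> \<open>This is the minimiser in \<open>u\<close> of
      \<open>(norm u)^2 - (norm (b n + b 0 * u))^2\<close>. The minimum is
      \<open>- (norm (b n))^2 / d\<close>, and adding \<open>T\<close> to it gives \<open>P\<close>;
      \<open>sq\<close> completes the square.\<close>
    define u0 where "u0 = cnj (b 0) * b n / of_real d"
    define X where "X = b (2 * n) + b n * u0"
    define P where "P = T - (norm (b n))\<^sup>2 / d"
    have sq: "(norm (u0 + w))\<^sup>2 - (norm (b n + b 0 * (u0 + w)))\<^sup>2 = d * (norm w)\<^sup>2 - (norm (b n))\<^sup>2 / d" for w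
    proof -
      have "complex_of_real ((norm (u0 + w))\<^sup>2 - (norm (b n + b 0 * (u0 + w)))\<^sup>2)
          = of_real (d * (norm w)\<^sup>2 - (norm (b n))\<^sup>2 / d)"
      proof -
        have b0: "b 0 * cnj (b 0) = 1 - of_real d"
          by (simp add: d_def complex_norm_square[symmetric])
        have dd: "complex_of_real d \<noteq> 0" using d by simp
        have u0: "cnj (b 0) * b n = of_real d * u0" "b 0 * cnj (b n) = of_real d * cnj u0"
          using dd by (simp_all add: u0_def)
        have "b 0 * u0 = (1 - of_real d) * b n / of_real d"
          by (simp add: u0_def flip: b0)
        hence e: "b n + b 0 * (u0 + w) = b n / of_real d + b 0 * w"
          using dd by (simp add: field_simps)
        have u0u0: "u0 * cnj u0 = (1 - of_real d) * (b n * cnj (b n)) / (of_real d)\<^sup>2"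
          by (simp add: u0_def flip: b0) (simp add: power2_eq_square)
        have "(u0 + w) * cnj (u0 + w) - (b n / of_real d + b 0 * w) * cnj (b n / of_real d + b 0 * w)
          = u0 * cnj u0 + u0 * cnj w + w * cnj u0 + w * cnj w
            - (b n * cnj (b n) / (of_real d)\<^sup>2 + (cnj (b 0) * b n) * cnj w / of_real d
              + (b 0 * cnj (b n)) * w / of_real d + (b 0 * cnj (b 0)) * (w * cnj w))"
          by (simp add: algebra_simps power2_eq_square add_divide_distrib)
        also have "\<dots> = of_real d * (w * cnj w) - b n * cnj (b n) / of_real d"
          unfolding u0 b0 u0u0 using dd by (simp add: field_simps power2_eq_square)
        finally show ?thesis
          unfolding e by (simp only: complex_norm_square of_real_diff of_real_mult of_real_divide)
      qed
      thus ?thesis by (simp only: of_real_eq_iff)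
    qed
    have "(norm (X + b n * w))\<^sup>2 \<le> T * P + (d * T) * (norm w)\<^sup>2" for w
    proof -
      have "(norm (X + b n * w))\<^sup>2 = (norm (b (2 * n) + b n * (u0 + w)))\<^sup>2"
        by (simp add: X_def algebra_simps)
      also have "\<dots> \<le> (T + (norm (u0 + w))\<^sup>2 - (norm (b n + b 0 * (u0 + w)))\<^sup>2) * T"
        by (rule elim_s)
      also have "T + (norm (u0 + w))\<^sup>2 - (norm (b n + b 0 * (u0 + w)))\<^sup>2 = P + d * (norm w)\<^sup>2"
        using sq[of w] by (simp add: P_def)
      finally show ?thesis by (simp add: algebra_simps)
    qed
    note X = this
    from complex_quadratic_bound[OF this]
    have "(norm X)\<^sup>2 * (d * T) \<le> T * P * (d * T - (norm (b n))\<^sup>2)" .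
    \<comment> \<open>A second factor \<open>P\<close> appears, so that cancelling
      \<open>d * T\<close> leaves a comparison of squares.\<close>
    also have "d * T - (norm (b n))\<^sup>2 = d * P"
      using d by (simp add: P_def field_simps)
    finally have "(norm X)\<^sup>2 * (d * T) \<le> P\<^sup>2 * (d * T)"
      by (simp add: power2_eq_square mult_ac)
    hence "(norm X)\<^sup>2 \<le> P\<^sup>2"
      using d T by simp
    moreover have "P \<ge> 0"
    proof -
      have "0 \<le> (norm X)\<^sup>2" by simp
      also have "\<dots> \<le> T * P" using X[of 0] by simp
      finally show ?thesis using T by (simp add: zero_le_mult_iff)
    qed
    ultimately have XP: "norm X \<le> P"
      by (rule power2_le_imp_le)
    \<comment> \<open>Returning from \<open>X\<close> to \<open>b (2 * n)\<close> costs
      \<open>norm (b 0) * (norm (b n))^2 / d\<close>. Because \<open>d\<close> factors as a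
      difference of squares, the combined weight of \<open>(norm (b n))^2\<close> becomes
      \<open>1 / (1 + norm (b 0))\<close>.\<close>
    have "norm (b (2 * n)) = norm (X - b n * u0)" by (simp add: X_def)
    also have "\<dots> \<le> norm X + norm (b n * u0)" by (rule norm_triangle_ineq4)
    also have "norm (b n * u0) = norm (b 0) * (norm (b n))\<^sup>2 / d"
      using d by (simp add: u0_def norm_mult norm_divide power2_eq_square)
    also have "norm X + norm (b 0) * (norm (b n))\<^sup>2 / d \<le> T - (1 - norm (b 0)) * (norm (b n))\<^sup>2 / d"
      using XP by (simp add: P_def algebra_simps diff_divide_distrib)
    also have "(1 - norm (b 0)) * (norm (b n))\<^sup>2 / d = (norm (b n))\<^sup>2 / (1 + norm (b 0))"
    proof -
      have "d = (1 - norm (b 0)) * (1 + norm (b 0))"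
        by (simp add: d_def power2_eq_square algebra_simps)
      thus ?thesis using d by auto
    qed
    finally show ?thesis by (simp add: T_def S_def)
  qed
qed

subsection \<open>The Bohr sum\<close>

text \<open>Carlson's inequalities are summed over even and odd indices separately. The partial sums
  \<open>S n\<close> have generating function \<open>Q / (1 - x)\<close>, so the result is affine in
  \<open>Q\<close>, and the weight in front of \<open>Q\<close> on the left is exactly what makes
  its total coefficient zero.\<close>

lemma refined_Bohr_sum_le:
  assumes b: "toeplitz_contraction b" and r: "0 \<le> r" "r < 1"
    and A: "(\<lambda>n. norm (b n) * r ^ n) sums A"
    and Q: "(\<lambda>n. (norm (b n))\<^sup>2 * r ^ (2 * n)) sums Q"
  defines "a \<equiv> norm (b 0)"
  shows "A + (1 / (1 + a) + r / (1 - r)) * Q \<le> a + a\<^sup>2 / (1 + a) + r / (1 - r)"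
proof -
  define x where "x = r\<^sup>2"
  have x: "0 \<le> x" "x < 1"
    using r by (auto simp: x_def abs_square_less_1)
  define S where "S n = (\<Sum>i\<le>n. (norm (b i))\<^sup>2)" for n
  have a: "a \<ge> 0" by (simp add: a_def)
  have Q': "(\<lambda>n. (norm (b n))\<^sup>2 * x ^ n) sums Q"
    using Q by (simp add: x_def power_mult)
  have geo: "(\<lambda>n. x ^ n) sums (1 / (1 - x))"
    using x by (intro geometric_sums) auto
  have S: "(\<lambda>n. S n * x ^ n) sums (Q / (1 - x))"
  proof -
    have "(\<lambda>n. \<Sum>i\<le>n. ((norm (b i))\<^sup>2 * x ^ i) * x ^ (n - i)) sums
        ((\<Sum>n. (norm (b n))\<^sup>2 * x ^ n) * (\<Sum>n. x ^ n))"
      by (rule Cauchy_product_sums)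
        (use x sums_summable[OF Q'] sums_summable[OF geo] in \<open>auto simp: abs_mult power_abs\<close>)
    also have "(\<lambda>n. \<Sum>i\<le>n. ((norm (b i))\<^sup>2 * x ^ i) * x ^ (n - i)) = (\<lambda>n. S n * x ^ n)"
      by (rule ext) (simp add: S_def sum_distrib_right mult.assoc flip: power_add)
    finally show ?thesis
      by (simp flip: sums_unique[OF Q'] sums_unique[OF geo])
  qed
  \<comment> \<open>D corrects the term of index 0, where the even inequality does not apply.\<close>
  define D where "D = a - 1 + a\<^sup>2 - a / (1 + a) * a\<^sup>2"
  define ev where "ev n = x ^ n - S n * x ^ n + a / (1 + a) * ((norm (b n))\<^sup>2 * x ^ n)
      + (if n = 0 then D else 0)" for n :: nat
  define od where "od n = r * (x ^ n - S n * x ^ n)" for n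
  have ev: "ev sums (1 / (1 - x) - Q / (1 - x) + a / (1 + a) * Q + D)"
    unfolding ev_def by (intro sums_add sums_diff sums_mult geo S Q' sums_single)
  have od: "od sums (r * (1 / (1 - x) - Q / (1 - x)))"
    unfolding od_def by (intro sums_mult sums_diff geo S)
  have "A \<le> r * (1 / (1 - x) - Q / (1 - x)) + (1 / (1 - x) - Q / (1 - x) + a / (1 + a) * Q + D)"
  \<comment> \<open>\<open>sums_if\<close> interleaves the two series, \<open>ev\<close> at even and
    \<open>od\<close> at odd indices.\<close>
  proof (rule sums_le[OF _ A sums_if[OF od ev]])
    fix n
    show "norm (b n) * r ^ n \<le> (if even n then ev (n div 2) else od ((n - 1) div 2))"
    proof (cases "even n")
      case True
      then obtain m where m: "n = 2 * m" by auto
      have "norm (b (2 * m)) * x ^ m \<le> ev m"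
      proof (cases "m = 0")
        case True
        thus ?thesis by (simp add: ev_def D_def S_def a_def)
      next
        case False
        have "norm (b (2 * m)) \<le> 1 - (\<Sum>i<m. (norm (b i))\<^sup>2) - (norm (b m))\<^sup>2 / (1 + a)"
          unfolding a_def by (rule Carlson_even[OF b]) (use False in auto)
        \<comment> \<open>\<open>S m\<close> includes the square of index \<open>m\<close>, which
          the even inequality subtracts with weight \<open>1 / (1 + a)\<close> only; the surplus
          \<open>a / (1 + a)\<close> is restored.\<close>
        also have "\<dots> = 1 - S m + a / (1 + a) * (norm (b m))\<^sup>2"
          using a by (simp add: S_def lessThan_Suc_atMost[symmetric] field_simps)
        finally have "norm (b (2 * m)) * x ^ m \<le> (1 - S m + a / (1 + a) * (norm (b m))\<^sup>2) * x ^ m"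
          using x by (intro mult_right_mono) auto
        thus ?thesis using False by (simp add: ev_def algebra_simps)
      qed
      thus ?thesis by (simp add: m x_def power_mult)
    next
      case False
      then obtain m where m: "n = 2 * m + 1" by (elim oddE)
      have "r ^ n = r * x ^ m" "(n - 1) div 2 = m"
        by (simp_all add: m x_def power_mult)
      moreover have "norm (b n) * (r * x ^ m) \<le> (1 - S m) * (r * x ^ m)"
        using r x Carlson_odd[OF b, of m] unfolding S_def m by (intro mult_right_mono) auto
      ultimately show ?thesis using False by (simp add: od_def algebra_simps)
    qed
  qed
  also have "\<dots> = (1 - Q) * ((1 + r) / (1 - x)) + a / (1 + a) * Q + D"
    by (simp add: add_divide_distrib diff_divide_distrib algebra_simps)
  also have "(1 + r) / (1 - x) = 1 / (1 - r)"
  proof -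
    have "1 - x = (1 + r) * (1 - r)" by (simp add: x_def power2_eq_square algebra_simps)
    thus ?thesis using r by simp
  qed
  finally have "A + (1 / (1 + a) + r / (1 - r)) * Q
      \<le> (1 - Q) * (1 / (1 - r)) + a / (1 + a) * Q + D + (1 / (1 + a) + r / (1 - r)) * Q"
    by simp
  \<comment> \<open>The coefficient of \<open>Q\<close> is
    \<open>- 1 / (1 - r) + a / (1 + a) + 1 / (1 + a) + r / (1 - r) = 0\<close>.\<close>
  also have "\<dots> = a + a\<^sup>2 / (1 + a) + r / (1 - r)"
    using a r by (simp add: D_def divide_simps) (simp add: power2_eq_square algebra_simps)
  finally show ?thesis .
qed

text \<open>Shifting the index by \<open>k\<close> takes \<open>r ^ k\<close> out of the first sum
  and \<open>r ^ (2 * k)\<close> out of the second, where the negative powers reduce it to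
  \<open>r ^ k\<close>. Nonnegative terms let \<open>sums\<close> pass to
  \<open>infsum\<close>.\<close>

lemma bohr_lhs_eq:
  assumes r: "0 < r" "r < 1"
    and A: "(\<lambda>n. norm (taylor_coeff f (n + k)) * r ^ n) sums A"
    and Q: "(\<lambda>n. (norm (taylor_coeff f (n + k)))\<^sup>2 * r ^ (2 * n)) sums Q"
  shows "bohr_lhs k f r = r ^ k * (A + (1 / (1 + norm (taylor_coeff f k)) + r / (1 - r)) * Q)"
proof -
  have shift: "infsum \<phi> {k..} = s" if "(\<lambda>n. \<phi> (n + k)) sums s" "\<And>n. \<phi> (n + k) \<ge> 0" for \<phi> :: "nat \<Rightarrow> real" and s
  proof -
    have "((\<lambda>n. \<phi> (n + k)) has_sum s) UNIV"
      using that by (rule sums_nonneg_imp_has_sum)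
    hence "(\<phi> has_sum s) (range (\<lambda>n. n + k))"
      by (subst has_sum_reindex) (auto simp: inj_on_def o_def)
    moreover have "range (\<lambda>n. n + k) = {k..}"
      by (auto simp: image_def intro: exI[of _ "_ - k"]) (metis add.commute le_iff_add)
    ultimately show ?thesis by (simp add: infsumI)
  qed
  have 1: "(\<Sum>\<^sub>\<infinity>n\<in>{k..}. norm (taylor_coeff f n) * r ^ n) = r ^ k * A"
    using sums_mult[OF A, of "r ^ k"] r by (intro shift) (simp_all add: power_add mult_ac)
  have 2: "(\<Sum>\<^sub>\<infinity>n\<in>{k..}. (norm (taylor_coeff f n))\<^sup>2 * r ^ (2 * n)) = r ^ (2 * k) * Q"
    using sums_mult[OF Q, of "r ^ (2 * k)"] r by (intro shift) (simp_all add: power_add mult_ac)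
  have 3: "r powi (- int k) * r ^ (2 * k) = r ^ k" "r powi (1 - int k) * r ^ (2 * k) = r * r ^ k"
    using r by (simp_all add: power_int_minus power_int_diff field_simps flip: power_add mult_2)
  have "bohr_lhs k f r = r ^ k * A + ((r powi (- int k) * r ^ (2 * k)) / (1 + norm (taylor_coeff f k))
      + (r powi (1 - int k) * r ^ (2 * k)) / (1 - r)) * Q"
    unfolding bohr_lhs_def 1 2 by (simp add: algebra_simps)
  thus ?thesis unfolding 3 by (simp add: algebra_simps)
qed

section \<open>The majorant and the root of the equation\<close>

definition bohr_majorant :: "nat \<Rightarrow> real \<Rightarrow> real \<Rightarrow> real" where
  "bohr_majorant k a r = r ^ k * (a + a\<^sup>2 / (1 + a) + r / (1 - r))"

lemma bohr_lhs_le_majorant: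
  assumes f: "f \<in> class_B_vanishing k" and r: "0 < r" "r < 1"
  shows "bohr_lhs k f r \<le> bohr_majorant k (norm (taylor_coeff f k)) r"
proof -
  have fB: "f \<in> class_B" using f by (simp add: class_B_vanishing_def)
  have geo: "summable (\<lambda>n. x ^ n)" if "0 \<le> x" "x < 1" for x :: real
    using that by (intro summable_geometric) auto
  have "summable (\<lambda>n. norm (taylor_coeff f (n + k)) * r ^ n)"
    by (rule summable_comparison_test'[OF geo[of r]])
      (use r class_B_coeff_bound[OF fB] in \<open>auto simp: abs_mult intro!: mult_left_le_one_le\<close>)
  moreover have "summable (\<lambda>n. (norm (taylor_coeff f (n + k)))\<^sup>2 * r ^ (2 * n))"
  proof (rule summable_comparison_test'[OF geo[of "r\<^sup>2"]])
    show "r\<^sup>2 < 1" using r by (simp add: abs_square_less_1)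
    show "norm ((norm (taylor_coeff f (n + k)))\<^sup>2 * r ^ (2 * n)) \<le> (r\<^sup>2) ^ n" for n
      using r class_B_coeff_bound[OF fB, of "n + k"]
      by (auto simp: power_mult intro!: mult_left_le_one_le power_le_one)
  qed auto
  ultimately obtain A Q where A: "(\<lambda>n. norm (taylor_coeff f (n + k)) * r ^ n) sums A"
      and Q: "(\<lambda>n. (norm (taylor_coeff f (n + k)))\<^sup>2 * r ^ (2 * n)) sums Q"
    by (auto simp: summable_def)
  show ?thesis
    unfolding bohr_lhs_eq[OF r A Q] bohr_majorant_def
    using refined_Bohr_sum_le[OF class_B_vanishing_toeplitz_contraction[OF f] _ _ A Q] r
    by (intro mult_left_mono) auto
qed

text \<open>Clearing denominators in the majorant gives the equation; the prefactor is positive, so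
  for \<open>r < 1\<close> the roots are the points where the majorant equals 1.\<close>

lemma rho_fun_eq_majorant:
  assumes "0 \<le> a" "r < 1"
  shows "rho_fun k a r = (1 + a) * (1 - r) * (1 - bohr_majorant k a r)"
proof -
  have "(1 + a) * (1 - r) * (a + a\<^sup>2 / (1 + a) + r / (1 - r)) = 2 * a\<^sup>2 + a + r * (1 - 2 * a\<^sup>2)"
    using assms by (simp add: divide_simps) (simp add: power2_eq_square algebra_simps)
  hence "(1 + a) * (1 - r) * bohr_majorant k a r = r ^ k * (2 * a\<^sup>2 + a + r * (1 - 2 * a\<^sup>2))"
    unfolding bohr_majorant_def by (metis mult.left_commute)
  thus ?thesis by (simp add: rho_fun_def right_diff_distrib)
qed

lemma bohr_majorant_strict_mono:
  assumes "0 < a" "0 < r" "r < s" "s < 1"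
  shows "bohr_majorant k a r < bohr_majorant k a s"
  unfolding bohr_majorant_def
proof (rule mult_le_less_imp_less)
  show "r ^ k \<le> s ^ k" using assms by (intro power_mono) auto
  show "a + a\<^sup>2 / (1 + a) + r / (1 - r) < a + a\<^sup>2 / (1 + a) + s / (1 - s)"
  proof -
    have "r / (1 - r) < s / (1 - s)"
      using assms by (simp add: frac_less)
    thus ?thesis by simp
  qed
  show "0 < r ^ k" using assms by simp
  show "0 \<le> a + a\<^sup>2 / (1 + a) + r / (1 - r)" using assms by simp
qed

text \<open>\<open>rho_fun k a\<close> takes the values \<open>1 + a\<close> at 0 and
  \<open>- (1 + a)\<close> at 1, which gives a root strictly between. Two roots would give the
  strictly increasing majorant the value 1 twice.\<close>

lemma rho_fun_unique_root:
  assumes "k \<ge> 2" "0 < a"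
  shows "\<exists>!r. r \<in> {0<..<1} \<and> rho_fun k a r = 0"
proof -
  have "\<exists>r\<ge>0. r \<le> 1 \<and> rho_fun k a r = 0"
    by (rule IVT2') (use assms in \<open>auto simp: rho_fun_def power_0_left intro!: continuous_intros\<close>)
  then obtain r where r: "0 \<le> r" "r \<le> 1" "rho_fun k a r = 0" by blast
  have "r \<noteq> 0" "r \<noteq> 1"
    using r(3) assms by (auto simp: rho_fun_def power_0_left)
  with r have r: "r \<in> {0<..<1}" "rho_fun k a r = 0" by auto
  have root: "bohr_majorant k a s = 1" if "s \<in> {0<..<1}" "rho_fun k a s = 0" for s
    using that rho_fun_eq_majorant[of a s k] assms by auto
  have "s = r" if "s \<in> {0<..<1}" "rho_fun k a s = 0" for s
    using root[OF that] root[OF r] that(1) r(1)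
      bohr_majorant_strict_mono[of a r s k] bohr_majorant_strict_mono[of a s r k] assms
    by (cases s r rule: linorder_cases) auto
  with r show ?thesis by blast
qed

subsection \<open>The extremal functions\<close>

text \<open>The right-hand form displays the coefficients: \<open>c\<close> at index
  \<open>k\<close>, and \<open>- (1 - c^2) * c ^ (n - 1)\<close> at index \<open>k + n\<close> for
  positive \<open>n\<close>.\<close>

lemma Blaschke_has_fps_expansion:
  fixes c :: complex
  shows "(\<lambda>z. z ^ k * ((c - z) / (1 - c * z))) has_fps_expansion
     fps_X ^ k * (fps_const c - fps_const (1 - c\<^sup>2) * (fps_X * Abs_fps (\<lambda>n. c ^ n)))"
proof -
  let ?F = "Abs_fps (\<lambda>n. c ^ n)"
  have F: "(1 - fps_const c * fps_X) * ?F = 1"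
  proof (rule fps_ext)
    show "fps_nth ((1 - fps_const c * fps_X) * ?F) n = fps_nth 1 n" for n
      by (cases n) (simp_all add: left_diff_distrib mult.assoc)
  qed
  hence "(fps_const c - fps_X) / (1 - fps_const c * fps_X) = (fps_const c - fps_X) * ?F"
    by (simp add: fps_divide_unit fps_inverse_unique[OF F])
  \<comment> \<open>The numerator is split as
    \<open>c - X = c * (1 - c * X) - (1 - c^2) * X\<close>.\<close>
  also have "\<dots> = fps_const c * ((1 - fps_const c * fps_X) * ?F) - fps_const (1 - c\<^sup>2) * (fps_X * ?F)"
    by (simp add: algebra_simps power2_eq_square flip: fps_const_mult fps_const_sub)
  also have "\<dots> = fps_const c - fps_const (1 - c\<^sup>2) * (fps_X * ?F)"
    by (simp add: F)
  finally have eq: "fps_const c - fps_const (1 - c\<^sup>2) * (fps_X * ?F) =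
      (fps_const c - fps_X) / (1 - fps_const c * fps_X)" ..
  show ?thesis
    unfolding eq
    by (intro fps_expansion_intros) simp
qed

text \<open>The squared moduli of denominator and numerator differ by
  \<open>(1 - a^2) * (1 - (norm z)^2)\<close>, which is nonnegative.\<close>

lemma norm_Blaschke_le_1:
  fixes z :: complex
  assumes "0 \<le> a" "a \<le> 1" "norm z < 1"
  shows "norm ((of_real a - z) / (1 - of_real a * z)) \<le> 1"
proof -
  have "(norm (1 - of_real a * z))\<^sup>2 - (norm (of_real a - z))\<^sup>2 = (1 - a\<^sup>2) * (1 - (norm z)\<^sup>2)"
    unfolding cmod_power2 by (simp add: power2_eq_square algebra_simps)
  also have "\<dots> \<ge> 0"
    using assms by (intro mult_nonneg_nonneg) (auto simp: power_le_one)
  finally have "norm (of_real a - z) \<le> norm (1 - of_real a * z)"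
    by (rule power2_le_imp_le[OF _ norm_ge_zero, OF iffD1[OF diff_ge_0_iff_ge]])
  thus ?thesis by (simp add: norm_divide divide_le_eq_1)
qed

text \<open>The coefficients of the Blaschke-type function are geometric after the first, so both
  sums have closed forms. For \<open>a = 1\<close> the function is just \<open>z ^ k\<close> on the
  disk.\<close>

lemma bohr_majorant_attained:
  assumes a: "0 \<le> a" "a \<le> 1" and r: "0 < r" "r < 1"
  obtains f where "f \<in> class_B_vanishing k" "norm (taylor_coeff f k) = a"
    "bohr_lhs k f r = bohr_majorant k a r"
proof
  define c where "c = complex_of_real a"
  let ?f = "\<lambda>z. z ^ k * ((c - z) / (1 - c * z))"
  have expansion: "fps_expansion ?f 0 =
      fps_X ^ k * (fps_const c - fps_const (1 - c\<^sup>2) * (fps_X * Abs_fps (\<lambda>n. c ^ n)))"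
    by (rule fps_expansion_eqI[OF Blaschke_has_fps_expansion])
  have "1 - c * z \<noteq> 0" if "norm z < 1" for z
  proof
    assume "1 - c * z = 0"
    hence "norm (c * z) = 1" by simp
    moreover have "norm (c * z) \<le> norm z"
      using a by (auto simp: c_def norm_mult intro!: mult_left_le_one_le)
    ultimately show False using that by simp
  qed
  hence "?f holomorphic_on ball 0 1"
    by (intro holomorphic_intros) auto
  moreover have "norm (?f z) \<le> 1" if "norm z < 1" for z
    using norm_Blaschke_le_1[OF a that] that
    by (auto simp: c_def norm_mult norm_power simp del: times_divide_eq_right
        intro!: mult_le_one power_le_one)
  ultimately have "?f \<in> class_B"
    by (simp add: class_B_def analytic_on_open)
  moreover have "(deriv ^^ j) ?f 0 = 0" if "j < k" for j
  proof -
    have "taylor_coeff ?f j = 0"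
      unfolding expansion using that by (simp add: fps_X_power_mult_nth)
    thus ?thesis by (simp add: fps_expansion_def)
  qed
  ultimately show "?f \<in> class_B_vanishing k"
    by (simp add: class_B_vanishing_def)
  \<comment> \<open>For \<open>a = 0\<close> the convention \<open>0 ^ 0 = 1\<close> yields the
    value 1 at \<open>n = 1\<close>, as it must for \<open>- z ^ (k + 1)\<close>.\<close>
  have coeff: "norm (taylor_coeff ?f (n + k)) = (if n = 0 then a else (1 - a\<^sup>2) * a ^ (n - 1))" for n
  proof -
    have "norm (1 - c\<^sup>2) = 1 - a\<^sup>2"
    proof -
      have "1 - c\<^sup>2 = of_real (1 - a\<^sup>2)" by (simp add: c_def)
      thus ?thesis using a by (simp only: norm_of_real) (simp add: power_le_one)
    qed
    thus ?thesis
      unfolding expansion using a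
      by (auto simp: fps_X_power_mult_nth norm_mult norm_power c_def)
  qed
  from coeff[of 0] show "norm (taylor_coeff ?f k) = a" by simp
  have ar: "a * r < 1" "0 \<le> a * r"
    using a r by (auto intro: le_less_trans[OF mult_left_le_one_le])
  hence ar2: "norm ((a * r)\<^sup>2) < 1" by (simp add: abs_square_less_1)
  have "(\<lambda>n. norm (taylor_coeff ?f (Suc n + k)) * r ^ Suc n) sums ((1 - a\<^sup>2) * r * (1 / (1 - a * r)))"
    using sums_mult[OF geometric_sums[of "a * r"], of "(1 - a\<^sup>2) * r"] ar
    unfolding coeff by (simp add: power_mult_distrib mult_ac)
  from sums_Suc[OF this]
  have A: "(\<lambda>n. norm (taylor_coeff ?f (n + k)) * r ^ n) sums ((1 - a\<^sup>2) * r * (1 / (1 - a * r)) + a)"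
    unfolding coeff by simp
  have "(\<lambda>n. (norm (taylor_coeff ?f (Suc n + k)))\<^sup>2 * r ^ (2 * Suc n)) sums
      ((1 - a\<^sup>2)\<^sup>2 * r\<^sup>2 * (1 / (1 - (a * r)\<^sup>2)))"
    using sums_mult[OF geometric_sums[of "(a * r)\<^sup>2"], of "(1 - a\<^sup>2)\<^sup>2 * r\<^sup>2", OF ar2]
    unfolding coeff by (simp add: power_mult_distrib power_mult power2_eq_square mult_ac)
  from sums_Suc[OF this]
  have Q: "(\<lambda>n. (norm (taylor_coeff ?f (n + k)))\<^sup>2 * r ^ (2 * n)) sums
      ((1 - a\<^sup>2)\<^sup>2 * r\<^sup>2 * (1 / (1 - (a * r)\<^sup>2)) + a\<^sup>2)"
    unfolding coeff by simp
  \<comment> \<open>In this form the numerator cancels a factor of \<open>1 - (a * r)^2\<close>.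
    What is left of the quadratic tail combines with the linear tail, and \<open>1 - a * r\<close>
    disappears as well.\<close>
  have w: "1 / (1 + a) + r / (1 - r) = (1 + a * r) / ((1 + a) * (1 - r))"
    using a r by (simp add: field_simps)
  have "(1 / (1 + a) + r / (1 - r)) * ((1 - a\<^sup>2)\<^sup>2 * r\<^sup>2 * (1 / (1 - (a * r)\<^sup>2)))
      = (1 - a\<^sup>2) * (1 - a) * r\<^sup>2 / ((1 - r) * (1 - a * r))"
  proof -
    have "1 - (a * r)\<^sup>2 = (1 + a * r) * (1 - a * r)" "(1 - a\<^sup>2)\<^sup>2 = (1 - a\<^sup>2) * (1 - a) * (1 + a)"
      by (simp_all add: power2_eq_square algebra_simps)
    moreover have "1 + a * r \<noteq> 0" "1 + a \<noteq> 0" "1 - r \<noteq> 0" "1 - a * r \<noteq> 0"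
      using a r ar by linarith+
    ultimately show ?thesis unfolding w by simp
  qed
  moreover have "(1 - a\<^sup>2) * r * (1 / (1 - a * r)) + (1 - a\<^sup>2) * (1 - a) * r\<^sup>2 / ((1 - r) * (1 - a * r))
      = (1 - a\<^sup>2) * r / (1 - r)"
    using ar r by (simp add: divide_simps) (simp add: power2_eq_square algebra_simps)
  moreover have "(1 - a\<^sup>2) * r / (1 - r) + a + (1 / (1 + a) + r / (1 - r)) * a\<^sup>2
      = a + a\<^sup>2 / (1 + a) + r / (1 - r)"
    using a r by (simp add: divide_simps) (simp add: power2_eq_square algebra_simps)
  ultimately have "((1 - a\<^sup>2) * r * (1 / (1 - a * r)) + a) + (1 / (1 + a) + r / (1 - r)) *
      ((1 - a\<^sup>2)\<^sup>2 * r\<^sup>2 * (1 / (1 - (a * r)\<^sup>2)) + a\<^sup>2) = a + a\<^sup>2 / (1 + a) + r / (1 - r)"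
    unfolding distrib_left by linarith
  thus "bohr_lhs k ?f r = bohr_majorant k a r"
    unfolding bohr_lhs_eq[OF r A Q] bohr_majorant_def \<open>norm (taylor_coeff ?f k) = a\<close> by simp
qed

theorem theorem3:
  fixes k :: nat and a :: real
  assumes "k \<ge> 2" and "0 < a" and "a \<le> 1"
  shows "(\<exists>!r. r \<in> {0<..<1} \<and> rho_fun k a r = 0)
    \<and> (\<forall>f\<in>class_B_vanishing k. norm (taylor_coeff f k) = a \<longrightarrow>
         (\<forall>r\<in>{0..rho k a}. bohr_lhs k f r \<le> 1))
    \<and> (\<forall>\<rho>\<in>{rho k a<..<1}. \<exists>f\<in>class_B_vanishing k.
         norm (taylor_coeff f k) = a \<and> (\<exists>r\<in>{0..\<rho>}. \<not> bohr_lhs k f r \<le> 1))"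
proof (intro conjI ballI impI)
  show ex1: "\<exists>!r. r \<in> {0<..<1} \<and> rho_fun k a r = 0"
    by (rule rho_fun_unique_root) fact+
  \<comment> \<open>Unique existence makes the definite description in \<open>rho\<close> denote the
    root.\<close>
  have rho: "0 < rho k a" "rho k a < 1" "rho_fun k a (rho k a) = 0"
    using theI'[OF ex1] unfolding rho_def[symmetric] by auto
  hence one: "bohr_majorant k a (rho k a) = 1"
    using rho_fun_eq_majorant[of a "rho k a" k] assms by auto
  show "bohr_lhs k f r \<le> 1"
    if "f \<in> class_B_vanishing k" "norm (taylor_coeff f k) = a" "r \<in> {0..rho k a}" for f r
  \<comment> \<open>The comparison with the majorant is available only for positive
    \<open>r\<close>.\<close>
  proof (cases "r = 0")
    case True
    thus ?thesis using assms by (simp add: bohr_lhs_0)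
  next
    case False
    with that rho have r: "0 < r" "r \<le> rho k a" "r < 1" by auto
    have "bohr_lhs k f r \<le> bohr_majorant k a r"
      using bohr_lhs_le_majorant[OF that(1) r(1,3)] that(2) by simp
    also have "\<dots> \<le> bohr_majorant k a (rho k a)"
      using bohr_majorant_strict_mono[of a r "rho k a" k] assms r rho
      by (cases "r = rho k a") auto
    finally show ?thesis by (simp add: one)
  qed
  show "\<exists>f\<in>class_B_vanishing k. norm (taylor_coeff f k) = a \<and> (\<exists>r\<in>{0..\<rho>}. \<not> bohr_lhs k f r \<le> 1)"
    if "\<rho> \<in> {rho k a<..<1}" for \<rho>
  proof -
    have \<rho>: "rho k a < \<rho>" "0 < \<rho>" "\<rho> < 1" using that rho by auto
    \<comment> \<open>The inequality already fails at the radius \<rho> itself.\<close>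
    have "bohr_majorant k a \<rho> > 1"
      using bohr_majorant_strict_mono[of a "rho k a" \<rho> k] assms \<rho> rho one by simp
    moreover obtain f where "f \<in> class_B_vanishing k" "norm (taylor_coeff f k) = a"
        "bohr_lhs k f \<rho> = bohr_majorant k a \<rho>"
      using bohr_majorant_attained[of a \<rho> k] assms \<rho> by auto
    ultimately show ?thesis
      using \<rho> by (intro bexI[of _ f] conjI bexI[of _ \<rho>]) auto
  qed
qed

end
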